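(* Let $n \ge 1$ be an integer. The set $R(\mathcal{B}_n) \subseteq [-1,1]^{E_n}$ of all correlation vectors of $n$-variate symmetric Bernoulli distributions is a polytope whose set of vertices is $\{R(\pi_1),\ldots,R(\pi_{2^{n-1}})\}$. That is, a vector $\rho \in [-1,1]^{E_n}$ is the correlation vector $R(\mu)$ of some distribution $\mu \in \mathcal{B}_n$ if and only if $\rho$ can be written as a convex combination of $R(\pi_1),\ldots,R(\pi_{2^{n-1}})$.
   Context: $E_n = \{(i,j) : 1 \le i < j \le n\}$ is the edge set of the complete graph on $\{1,\ldots,n\}$. $\mathcal{B}_n$ is the set of all $n$-variate symmetric Bernoulli distributions, i.e. probability measures $\mu$ on $\{0,1\}^n$ all of whose one-dimensional marginals are Bernoulli$(1/2)$: $\sum_{\mathbf{x}\in\{0,1\}^n:\, x_k = 0}\mu(\mathbf{x}) = \tfrac12$ for $k=1,\ldots,n$. The correlation map $R:\mathcal{B}_n \to [-1,1]^{E_n}$ sends $\mu$ to the vector $R(\mu)=\rho^\mu$ with $\rho^\mu(i,j) = \operatorname{corr}(B_i,B_j) = 4\,\mathbb{E}_\mu[B_iB_j]-1$, where $(B_1,\ldots,B_n)\sim\mu$. For $\mathbf{x}\in\{0,1\}^n$, $\pi_{\mathbf{x}}$ denotes the uniform distribution on the diagonal $D_{\mathbf{x}}=\{\mathbf{x},\mathbf{1}-\mathbf{x}\}$, where $\mathbf{1}=(1,\ldots,1)$; thus $\pi_{\mathbf{x}}(\mathbf{x})=\pi_{\mathbf{x}}(\mathbf{1}-\mathbf{x})=\tfrac12$,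 and $\pi_{\mathbf x}\in\mathcal{B}_n$. Each diagonal contains exactly one vector $\mathbf{y}$ with $y_1=0$; for such $\mathbf y$ the number $b(\mathbf{y}) = 1+\sum_{j=1}^n y_j 2^{n-j}$ lies in $\{1,\ldots,2^{n-1}\}$. For $k\in\{1,\ldots,2^{n-1}\}$, $\pi_k$ is the distribution $\pi_{\mathbf{y}}$ for the unique $\mathbf y$ with $y_1=0$ and $b(\mathbf{y})=k$. A polytope is the convex hull of a finite set of points; its vertices are its extreme points. *)

theory Defs
  imports "HOL-Analysis.Analysis" "HOL-Probability.Probability" "HOL-Library.Function_Algebras"
begin

(* The library has no vector space of functions on a varying finite index set. We use the
   pointwise real vector space structure on all functions; the space of real vectors indexed by a
   finite set E is then the subspace of the functions vanishing outside E. *)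

instantiation "fun" :: (type, real_vector) real_vector
begin

definition scaleR_fun :: "real \<Rightarrow> ('a \<Rightarrow> 'b) \<Rightarrow> 'a \<Rightarrow> 'b"
  where "scaleR_fun c f = (\<lambda>x. c *\<^sub>R f x)"

instance
  by standard (auto simp: scaleR_fun_def fun_eq_iff scaleR_add_right scaleR_add_left)

end

lemma scaleR_fun_apply [simp]: "(c *\<^sub>R f) x = c *\<^sub>R f x"
  by (simp add: scaleR_fun_def)

definition edges :: "nat \<Rightarrow> (nat \<times> nat) set"
  where "edges n = {(i, j). 1 \<le> i \<and> i < j \<and> j \<le> n}"

definition edge_box :: "nat \<Rightarrow> (nat \<times> nat \<Rightarrow> real) set"
  where "edge_box n = {\<rho>. (\<forall>e\<in>edges n. \<rho> e \<in> {-1..1}) \<and> (\<forall>e. e \<notin> edges n \<longrightarrow> \<rho> e = 0)}"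

definition cube :: "nat \<Rightarrow> (nat \<Rightarrow> nat) set"
  where "cube n = {1..n} \<rightarrow>\<^sub>E {0, 1}"

definition sym_bernoulli :: "nat \<Rightarrow> (nat \<Rightarrow> nat) pmf set"
  where "sym_bernoulli n =
    {\<mu>. set_pmf \<mu> \<subseteq> cube n \<and> (\<forall>k\<in>{1..n}. (\<Sum>x | x \<in> cube n \<and> x k = 0. pmf \<mu> x) = 1 / 2)}"

definition covariance :: "'a pmf \<Rightarrow> ('a \<Rightarrow> real) \<Rightarrow> ('a \<Rightarrow> real) \<Rightarrow> real"
  where "covariance \<mu> X Y = measure_pmf.expectation \<mu>
    (\<lambda>x. (X x - measure_pmf.expectation \<mu> X) * (Y x - measure_pmf.expectation \<mu> Y))"

definition corr :: "'a pmf \<Rightarrow> ('a \<Rightarrow> real) \<Rightarrow> ('a \<Rightarrow> real) \<Rightarrow> real"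
  where "corr \<mu> X Y =
    covariance \<mu> X Y / (sqrt (measure_pmf.variance \<mu> X) * sqrt (measure_pmf.variance \<mu> Y))"

definition corr_map :: "nat \<Rightarrow> (nat \<Rightarrow> nat) pmf \<Rightarrow> nat \<times> nat \<Rightarrow> real"
  where "corr_map n \<mu> =
    (\<lambda>(i, j). if (i, j) \<in> edges n then corr \<mu> (\<lambda>x. real (x i)) (\<lambda>x. real (x j)) else 0)"

definition flip :: "nat \<Rightarrow> (nat \<Rightarrow> nat) \<Rightarrow> nat \<Rightarrow> nat"
  where "flip n x = (\<lambda>i\<in>{1..n}. 1 - x i)"

definition diag_pmf :: "nat \<Rightarrow> (nat \<Rightarrow> nat) \<Rightarrow> (nat \<Rightarrow> nat) pmf"
  where "diag_pmf n x = pmf_of_set {x, flip n x}"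

definition diag_number :: "nat \<Rightarrow> (nat \<Rightarrow> nat) \<Rightarrow> nat"
  where "diag_number n y = 1 + (\<Sum>j=1..n. y j * 2 ^ (n - j))"

(* Meaningful for 1 <= n and 1 <= k <= 2 ^ (n - 1); see diag_number_ex1 below. *)
definition numbered_diag_pmf :: "nat \<Rightarrow> nat \<Rightarrow> (nat \<Rightarrow> nat) pmf"
  where "numbered_diag_pmf n k =
    diag_pmf n (THE y. y \<in> cube n \<and> y 1 = 0 \<and> diag_number n y = k)"


lemma finite_cube: "finite (cube n)"
  unfolding cube_def by (intro finite_PiE) auto

lemma cube_values: "x \<in> cube n \<Longrightarrow> i \<in> {1..n} \<Longrightarrow> x i = 0 \<or> x i = 1"
  unfolding cube_def by (auto simp: PiE_iff)

lemma sym_bernoulli_expectation: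
  assumes "\<mu> \<in> sym_bernoulli n" "i \<in> {1..n}"
  shows "measure_pmf.expectation \<mu> (\<lambda>x. real (x i)) = 1 / 2"
proof -
  have sub: "set_pmf \<mu> \<subseteq> cube n" using assms by (simp add: sym_bernoulli_def)
  have "measure_pmf.expectation \<mu> (\<lambda>x. real (x i)) = (\<Sum>x\<in>cube n. real (x i) * pmf \<mu> x)"
    by (rule integral_measure_pmf_real[OF finite_cube]) (use sub in auto)
  also have "\<dots> = (\<Sum>x\<in>cube n. pmf \<mu> x - (if x i = 0 then pmf \<mu> x else 0))"
    by (rule sum.cong) (use cube_values[OF _ assms(2)] in force)+
  also have "\<dots> = (\<Sum>x\<in>cube n. pmf \<mu> x) - (\<Sum>x | x \<in> cube n \<and> x i = 0. pmf \<mu> x)"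
    by (simp add: sum_subtractf sum.inter_filter[OF finite_cube])
  also have "\<dots> = 1 / 2"
    using assms sum_pmf_eq_1[OF finite_cube sub] by (simp add: sym_bernoulli_def)
  finally show ?thesis .
qed

lemma corr_sym_bernoulli:
  assumes \<mu>: "\<mu> \<in> sym_bernoulli n" and i: "i \<in> {1..n}" and j: "j \<in> {1..n}"
  shows "corr \<mu> (\<lambda>x. real (x i)) (\<lambda>x. real (x j)) =
    4 * measure_pmf.expectation \<mu> (\<lambda>x. real (x i) * real (x j)) - 1"
proof -
  have sub: "set_pmf \<mu> \<subseteq> cube n" using \<mu> by (simp add: sym_bernoulli_def)
  have int: "integrable (measure_pmf \<mu>) f" for f :: "(nat \<Rightarrow> nat) \<Rightarrow> real"
    by (rule integrable_measure_pmf_finite) (rule finite_subset[OF sub finite_cube])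
  have cov: "covariance \<mu> (\<lambda>x. real (x k)) (\<lambda>x. real (x l)) =
      measure_pmf.expectation \<mu> (\<lambda>x. real (x k) * real (x l)) - 1 / 4"
    if "k \<in> {1..n}" "l \<in> {1..n}" for k l
  proof -
    have "covariance \<mu> (\<lambda>x. real (x k)) (\<lambda>x. real (x l)) = measure_pmf.expectation \<mu>
        (\<lambda>x. real (x k) * real (x l) - real (x k) / 2 - real (x l) / 2 + 1 / 4)"
      unfolding covariance_def that[THEN sym_bernoulli_expectation[OF \<mu>]]
      by (intro Bochner_Integration.integral_cong) (auto simp: field_simps)
    also have "\<dots> = measure_pmf.expectation \<mu> (\<lambda>x. real (x k) * real (x l)) - 1 / 4"
      using that[THEN sym_bernoulli_expectation[OF \<mu>]] by (simp add: int)
    finally show ?thesis .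
  qed
  have var: "measure_pmf.variance \<mu> (\<lambda>x. real (x k)) = 1 / 4" if k: "k \<in> {1..n}" for k
  proof -
    have "measure_pmf.variance \<mu> (\<lambda>x. real (x k)) =
        covariance \<mu> (\<lambda>x. real (x k)) (\<lambda>x. real (x k))"
      by (simp add: covariance_def power2_eq_square)
    also have "\<dots> = measure_pmf.expectation \<mu> (\<lambda>x. real (x k) * real (x k)) - 1 / 4"
      by (rule cov[OF k k])
    also have "measure_pmf.expectation \<mu> (\<lambda>x. real (x k) * real (x k)) =
        measure_pmf.expectation \<mu> (\<lambda>x. real (x k))"
      by (rule integral_cong_AE) (use sub cube_values[OF _ k] in \<open>force simp: AE_measure_pmf_iff\<close>)+
    finally show ?thesis unfolding sym_bernoulli_expectation[OF \<mu> k] by simp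
  qed
  have "sqrt (1 / 4) = (1 / 2 :: real)" by (simp add: real_sqrt_divide)
  then show ?thesis
    by (simp add: corr_def var[OF i] var[OF j] cov[OF i j])
qed

lemma diag_number_bij_betw:
  assumes "n \<ge> 1"
  shows "bij_betw (diag_number n) {y \<in> cube n. y 1 = 0} {1..2 ^ (n - 1)}"
proof -
  have binary: "bij_betw (\<lambda>y. \<Sum>j=1..m. y j * 2 ^ (m - j)) (cube m) {..<2 ^ m}" for m
  proof (induction m)
    case 0
    show ?case by (simp add: cube_def bij_betw_def lessThan_Suc)
  next
    case (Suc m)
    let ?s = "\<lambda>m y. \<Sum>j=1..m. y j * 2 ^ (m - j) :: nat"
    have step: "?s (Suc m) y = 2 * ?s m (restrict y {1..m}) + y (Suc m)" for y
    proof -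
      have "(\<Sum>j=1..m. y j * 2 ^ (Suc m - j)) = (\<Sum>j=1..m. 2 * (restrict y {1..m} j * 2 ^ (m - j)))"
        by (rule sum.cong) (auto simp: Suc_diff_le)
      then show ?thesis by (simp add: sum_distrib_left)
    qed
    have restr: "restrict y {1..m} \<in> cube m" if "y \<in> cube (Suc m)" for y
      using that by (auto simp: cube_def PiE_iff)
    have bit: "y (Suc m) \<in> {0, 1}" if "y \<in> cube (Suc m)" for y
      using cube_values[OF that, of "Suc m"] by auto
    have inj: "inj_on (?s (Suc m)) (cube (Suc m))"
    proof (rule inj_onI)
      fix y z assume y: "y \<in> cube (Suc m)" and z: "z \<in> cube (Suc m)"
        and eq: "?s (Suc m) y = ?s (Suc m) z"
      have "y (Suc m) = z (Suc m) \<and> ?s m (restrict y {1..m}) = ?s m (restrict z {1..m})"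
        using eq[unfolded step] bit[OF y] bit[OF z] by auto presburger+
      then have last: "y (Suc m) = z (Suc m)" and "restrict y {1..m} = restrict z {1..m}"
        using Suc.IH restr[OF y] restr[OF z] by (auto simp: bij_betw_def inj_on_def)
      then have "y i = z i" if "i \<in> {1..m}" for i
        using that by (metis restrict_apply')
      with last have "\<forall>i\<in>{1..Suc m}. y i = z i"
        by (auto simp: le_Suc_eq)
      then show "y = z" using y z by (auto simp: cube_def intro: PiE_ext)
    qed
    have "?s (Suc m) ` cube (Suc m) \<subseteq> {..<2 ^ Suc m}"
    proof (rule image_subsetI)
      fix y assume y: "y \<in> cube (Suc m)"
      have "?s m (restrict y {1..m}) < 2 ^ m"
        using bij_betwE[OF Suc.IH] restr[OF y] by blast
      then show "?s (Suc m) y \<in> {..<2 ^ Suc m}"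
        using bit[OF y] unfolding step by auto
    qed
    moreover have "card (cube (Suc m)) = 2 ^ Suc m"
      by (simp add: cube_def card_PiE numeral_2_eq_2)
    ultimately have "?s (Suc m) ` cube (Suc m) = {..<2 ^ Suc m}"
      by (intro card_subset_eq) (simp_all only: finite_lessThan card_image[OF inj] card_lessThan)
    with inj show ?case by (simp add: bij_betw_def)
  qed
  have bij: "bij_betw (diag_number n) (cube n) {1..2 ^ n}"
  proof -
    have "bij_betw (\<lambda>k. 1 + k) {..<2 ^ n} {1..2 ^ n :: nat}"
      by (rule bij_betw_byWitness[where f' = "\<lambda>k. k - 1"]) auto
    from bij_betw_trans[OF binary this] show ?thesis
      by (simp add: diag_number_def[abs_def] o_def)
  qed
  have inj: "inj_on (diag_number n) {y \<in> cube n. y 1 = 0}"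
    using bij by (auto simp: bij_betw_def intro: inj_on_subset)
  have tail: "(\<Sum>j=2..n. y j * 2 ^ (n - j)) < 2 ^ (n - 1)" if y: "y \<in> cube n" for y
  proof -
    have "(\<Sum>j=2..n. y j * 2 ^ (n - j)) \<le> (\<Sum>j=2..n. 2 ^ (n - j))"
    proof (rule sum_mono)
      fix j assume "j \<in> {2..n}"
      then have "y j \<le> 1" using cube_values[OF y, of j] by auto
      then show "y j * 2 ^ (n - j) \<le> 2 ^ (n - j)" by simp
    qed
    also have "\<dots> = (\<Sum>i<n - 1. 2 ^ i)"
      by (rule sum.reindex_bij_witness[of _ "\<lambda>i. n - i" "\<lambda>j. n - j"]) auto
    also have "\<dots> < (2::nat) ^ (n - 1)"
      by (simp add: sum_power2 lessThan_atLeast0)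
    finally show ?thesis .
  qed
  have split: "diag_number n y = 1 + y 1 * 2 ^ (n - 1) + (\<Sum>j=2..n. y j * 2 ^ (n - j))" for y
    using assms by (simp add: diag_number_def sum.atLeast_Suc_atMost numeral_2_eq_2)
  have "diag_number n ` {y \<in> cube n. y 1 = 0} = {1..2 ^ (n - 1)}"
  proof (intro equalityI subsetI)
    fix k assume "k \<in> diag_number n ` {y \<in> cube n. y 1 = 0}"
    then obtain y where y: "y \<in> cube n" "y 1 = 0" "k = diag_number n y" by auto
    show "k \<in> {1..2 ^ (n - 1)}" using tail[OF y(1)] unfolding y(3) split y(2) by simp
  next
    fix k :: nat assume k: "k \<in> {1..2 ^ (n - 1)}"
    have "(2::nat) ^ (n - 1) \<le> 2 ^ n" by (rule power_increasing) auto
    with k have "k \<in> {1..2 ^ n}" unfolding atLeastAtMost_iff by linarith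
    then have "k \<in> diag_number n ` cube n" using bij_betw_imp_surj_on[OF bij] by simp
    then obtain y where y: "y \<in> cube n" "k = diag_number n y" by auto
    have "y 1 \<noteq> 1" using k unfolding y(2) split by auto
    then have "y 1 = 0" using cube_values[OF y(1), of 1] assms by auto
    with y show "k \<in> diag_number n ` {y \<in> cube n. y 1 = 0}" by auto
  qed
  with inj show ?thesis by (simp add: bij_betw_def)
qed

lemma diag_number_ex1:
  assumes "n \<ge> 1" "k \<in> {1..2 ^ (n - 1)}"
  shows "\<exists>!y. y \<in> cube n \<and> y 1 = 0 \<and> diag_number n y = k"
proof -
  have "k \<in> diag_number n ` {y \<in> cube n. y 1 = 0}"
    using bij_betw_imp_surj_on[OF diag_number_bij_betw[OF assms(1)]] assms(2) by simp
  then show ?thesis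
    using bij_betw_imp_inj_on[OF diag_number_bij_betw[OF assms(1)]]
    by (auto simp: inj_on_def simp del: One_nat_def)
qed

end

(* Write s i = 1 - 2 x_i for x in the cube. For mu in sym_bernoulli n the entry of R(mu) at (i, j)
   is E (1 - 2 B_i)(1 - 2 B_j), so R(mu) is the average under mu of the sign vectors (s i * s j),
   and the sign vector of x is R(pi_x). As sym_bernoulli n is closed under mixtures, its image is
   the convex hull of the R(pi_x); each of these is extreme because its entries are all extreme
   values of [-1, 1]. *)

theory Submission
  imports Defs
begin

section \<open>Convex hulls of finite indexed families\<close>

lemma convex_hull_image_finite:
  fixes f :: "'i \<Rightarrow> 'a::real_vector"
  assumes "finite I"
  shows "convex hull (f ` I) =
    {y. \<exists>c. (\<forall>i\<in>I. 0 \<le> c i) \<and> (\<Sum>i\<in>I. c i) = 1 \<and> y = (\<Sum>i\<in>I. c i *\<^sub>R f i)}"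
    (is "_ = ?C")
proof (intro equalityI hull_minimal convexI)
  show "f ` I \<subseteq> ?C"
  proof (rule image_subsetI, rule CollectI)
    fix i assume "i \<in> I"
    then show "\<exists>c. (\<forall>i\<in>I. 0 \<le> c i) \<and> (\<Sum>i\<in>I. c i) = 1 \<and> f i = (\<Sum>i\<in>I. c i *\<^sub>R f i)"
      using assms
      by (intro exI[of _ "\<lambda>j. if j = i then 1 else 0"])
        (auto simp: if_distrib[of "\<lambda>r. r *\<^sub>R _"] cong: if_cong)
  qed
next
  fix x y and u v :: real
  assume "x \<in> ?C" "y \<in> ?C" and uv: "0 \<le> u" "0 \<le> v" "u + v = 1"
  then obtain a b where a: "\<forall>i\<in>I. 0 \<le> a i" "sum a I = 1" "x = (\<Sum>i\<in>I. a i *\<^sub>R f i)"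
    and b: "\<forall>i\<in>I. 0 \<le> b i" "sum b I = 1" "y = (\<Sum>i\<in>I. b i *\<^sub>R f i)"
    by blast
  have "(\<Sum>i\<in>I. u * a i + v * b i) = 1"
    using a b uv by (simp add: sum.distrib flip: sum_distrib_left)
  moreover have "u *\<^sub>R x + v *\<^sub>R y = (\<Sum>i\<in>I. (u * a i + v * b i) *\<^sub>R f i)"
    by (simp add: a b scaleR_sum_right scaleR_left_distrib sum.distrib)
  ultimately show "u *\<^sub>R x + v *\<^sub>R y \<in> ?C"
    using a b uv by (intro CollectI exI[of _ "\<lambda>i. u * a i + v * b i"]) simp
next
  show "?C \<subseteq> convex hull (f ` I)"
    using assms by (auto intro!: convex_sum simp: hull_inc)
qed

section \<open>Sign vectors of points of the cube\<close>

definition sign_vector :: "nat \<Rightarrow> (nat \<Rightarrow> nat) \<Rightarrow> nat \<times> nat \<Rightarrow> real"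
  where "sign_vector n x =
    (\<lambda>(i, j). if (i, j) \<in> edges n then (1 - 2 * real (x i)) * (1 - 2 * real (x j)) else 0)"

lemma sign_vector_edge:
  assumes "x \<in> cube n" "e \<in> edges n"
  shows "sign_vector n x e \<in> {-1, 1}"
proof -
  obtain i j where e: "e = (i, j)" "i \<in> {1..n}" "j \<in> {1..n}"
    using assms(2) by (auto simp: edges_def)
  show ?thesis
    using cube_values[OF assms(1) e(2)] cube_values[OF assms(1) e(3)] assms(2) e(1)
    by (auto simp: sign_vector_def)
qed

lemma sign_vector_in_edge_box: "x \<in> cube n \<Longrightarrow> sign_vector n x \<in> edge_box n"
  using sign_vector_edge[of x n] by (fastforce simp: edge_box_def sign_vector_def)

lemma flip_in_cube: "x \<in> cube n \<Longrightarrow> flip n x \<in> cube n"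
  by (auto simp: flip_def cube_def)

lemma flip_neq:
  assumes "n \<ge> 1"
  shows "flip n x \<noteq> x"
proof
  assume "flip n x = x"
  then have "flip n x 1 = x 1" by simp
  \<comment> \<open>Subtraction is truncated, and \<open>1 - a = a\<close> fails for every natural
    number \<open>a\<close>; so \<open>x\<close> may be arbitrary here, inside the cube or
    not.\<close>
  with assms show False by (simp add: flip_def) arith
qed

text \<open>Passing to the opposite point negates every sign, and a product of two signs does not
  notice. Hence each diagonal has a single sign vector.\<close>

lemma sign_vector_flip:
  assumes "x \<in> cube n"
  shows "sign_vector n (flip n x) = sign_vector n x"
proof
  fix e :: "nat \<times> nat"
  obtain i j where e: "e = (i, j)" by force
  show "sign_vector n (flip n x) e = sign_vector n x e"
    using cube_values[OF assms, of i] cube_values[OF assms, of j]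
    by (auto simp: sign_vector_def flip_def edges_def e)
qed

section \<open>Correlation vectors as averages of sign vectors\<close>

lemma sum_fun_apply: "(\<Sum>i\<in>I. f i) x = (\<Sum>i\<in>I. f i x)"
  for f :: "'i \<Rightarrow> 'a \<Rightarrow> 'b::comm_monoid_add"
  by (induction I rule: infinite_finite_induct) auto

text \<open>Correlation is a quotient of moments, but the prescribed marginals fix all means and
  variances, so on \<open>sym_bernoulli n\<close> it becomes linear in \<open>pmf \<mu>\<close>.
  Both inclusions of the convex hull description rest on this.\<close>

lemma corr_map_eq_sum:
  assumes \<mu>: "\<mu> \<in> sym_bernoulli n"
  shows "corr_map n \<mu> = (\<Sum>x\<in>cube n. pmf \<mu> x *\<^sub>R sign_vector n x)"
proof
  fix e :: "nat \<times> nat"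
  have sub: "set_pmf \<mu> \<subseteq> cube n" using \<mu> by (simp add: sym_bernoulli_def)
  have int: "integrable (measure_pmf \<mu>) f" for f :: "(nat \<Rightarrow> nat) \<Rightarrow> real"
    by (rule integrable_measure_pmf_finite) (rule finite_subset[OF sub finite_cube])
  obtain i j where e: "e = (i, j)" by force
  show "corr_map n \<mu> e = (\<Sum>x\<in>cube n. pmf \<mu> x *\<^sub>R sign_vector n x) e"
  proof (cases "e \<in> edges n")
    case True
    then have ij: "i \<in> {1..n}" "j \<in> {1..n}" by (auto simp: edges_def e)
    have "corr_map n \<mu> e = 4 * measure_pmf.expectation \<mu> (\<lambda>x. real (x i) * real (x j)) - 1"
      using True by (simp add: corr_map_def e corr_sym_bernoulli[OF \<mu> ij])
    \<comment> \<open>Both means are 1/2, so the added terms have expectation 1 - 1 - 1 = -1. They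
      complete the integrand to (1 - 2 x_i)(1 - 2 x_j).\<close>
    also have "\<dots> = measure_pmf.expectation \<mu>
        (\<lambda>x. 1 - 2 * real (x i) - 2 * real (x j) + 4 * (real (x i) * real (x j)))"
      using ij[THEN sym_bernoulli_expectation[OF \<mu>]] by (simp add: int)
    also have "\<dots> = measure_pmf.expectation \<mu> (\<lambda>x. sign_vector n x e)"
      using True by (simp add: sign_vector_def e algebra_simps)
    also have "\<dots> = (\<Sum>x\<in>cube n. sign_vector n x e * pmf \<mu> x)"
      by (rule integral_measure_pmf_real[OF finite_cube]) (use sub in auto)
    finally show ?thesis by (simp add: sum_fun_apply mult.commute)
  next
    case False
    \<comment> \<open>Off the edges both sides have the default value 0.\<close>
    then show ?thesis by (simp add: corr_map_def sign_vector_def e sum_fun_apply)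
  qed
qed

lemma corr_map_in_convex_hull:
  assumes "\<mu> \<in> sym_bernoulli n"
  shows "corr_map n \<mu> \<in> convex hull (sign_vector n ` cube n)"
  unfolding corr_map_eq_sum[OF assms]
  using assms sum_pmf_eq_1[OF finite_cube, of \<mu> n]
  by (intro convex_sum finite_cube convex_convex_hull) (auto simp: sym_bernoulli_def hull_inc)

section \<open>Uniform distributions on diagonals\<close>

lemma pmf_diag_pmf:
  assumes "n \<ge> 1"
  shows "pmf (diag_pmf n x) y = (if y = x \<or> y = flip n x then 1 / 2 else 0)"
  using flip_neq[OF assms, of x]
  by (auto simp: diag_pmf_def pmf_of_set indicator_def card_insert_if)

text \<open>Vector-valued \<open>g\<close> serves two purposes: real indicators give the marginals
  of the diagonal distribution, and \<open>sign_vector n\<close> gives its correlation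
  vector.\<close>

lemma sum_pmf_diag_pmf:
  fixes g :: "(nat \<Rightarrow> nat) \<Rightarrow> 'a::real_vector"
  assumes "n \<ge> 1" "x \<in> cube n"
  shows "(\<Sum>y\<in>cube n. pmf (diag_pmf n x) y *\<^sub>R g y) = (1 / 2) *\<^sub>R (g x + g (flip n x))"
proof -
  have "(\<Sum>y\<in>cube n. pmf (diag_pmf n x) y *\<^sub>R g y) = (\<Sum>y\<in>{x, flip n x}. (1 / 2) *\<^sub>R g y)"
    by (rule sum.mono_neutral_cong_right)
      (use assms in \<open>auto simp: finite_cube flip_in_cube pmf_diag_pmf\<close>)
  then show ?thesis
    using flip_neq[OF assms(1), of x] by (simp add: scaleR_add_right)
qed

lemma diag_pmf_in_sym_bernoulli:
  assumes "n \<ge> 1" "x \<in> cube n"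
  shows "diag_pmf n x \<in> sym_bernoulli n"
proof -
  have "(\<Sum>y | y \<in> cube n \<and> y k = 0. pmf (diag_pmf n x) y) = 1 / 2" if k: "k \<in> {1..n}" for k
  proof -
    have "(\<Sum>y | y \<in> cube n \<and> y k = 0. pmf (diag_pmf n x) y) =
        (\<Sum>y\<in>cube n. pmf (diag_pmf n x) y *\<^sub>R (if y k = 0 then 1 else 0))"
      unfolding sum.inter_filter[OF finite_cube] by (rule sum.cong) auto
    \<comment> \<open>Coordinate \<open>k\<close> vanishes at exactly one of \<open>x\<close> and
      \<open>flip n x\<close>, so the two indicators add up to 1.\<close>
    also have "\<dots> = 1 / 2"
      unfolding sum_pmf_diag_pmf[OF assms] using cube_values[OF assms(2) k] k
      by (auto simp: flip_def)
    finally show ?thesis .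
  qed
  then show ?thesis
    using assms(2) by (auto simp: sym_bernoulli_def diag_pmf_def flip_in_cube)
qed

lemma corr_map_diag_pmf:
  assumes "n \<ge> 1" "x \<in> cube n"
  shows "corr_map n (diag_pmf n x) = sign_vector n x"
  unfolding corr_map_eq_sum[OF diag_pmf_in_sym_bernoulli[OF assms]] sum_pmf_diag_pmf[OF assms]
    sign_vector_flip[OF assms(2)]
  by (simp flip: scaleR_2)

section \<open>The set of correlation vectors as a convex hull\<close>

lemma convex_corr_map_image: "convex (corr_map n ` sym_bernoulli n)"
proof (rule convexI, clarify)
  fix \<mu> \<nu> and u v :: real
  assume \<mu>: "\<mu> \<in> sym_bernoulli n" and \<nu>: "\<nu> \<in> sym_bernoulli n"
    and uv: "0 \<le> u" "0 \<le> v" "u + v = 1"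
  \<comment> \<open>A biased coin realises the mixture: draw from \<open>\<mu>\<close> with
    probability \<open>u\<close>, otherwise from \<open>\<nu>\<close>.\<close>
  define \<kappa> where "\<kappa> = bernoulli_pmf u \<bind> (\<lambda>b. if b then \<mu> else \<nu>)"
  have v: "v = 1 - u" using uv by simp
  have pmf: "pmf \<kappa> x = u * pmf \<mu> x + v * pmf \<nu> x" for x
    using uv by (simp add: \<kappa>_def pmf_bind v mult.commute)
  have "set_pmf \<kappa> \<subseteq> cube n"
    using \<mu> \<nu> by (auto simp: \<kappa>_def sym_bernoulli_def split: if_splits)
  then have \<kappa>: "\<kappa> \<in> sym_bernoulli n"
    using \<mu> \<nu> by (simp add: sym_bernoulli_def pmf sum.distrib v flip: sum_distrib_left)
      (simp add: field_simps)
  \<comment> \<open>All three laws have the prescribed marginals, so the averaging formula applies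
    to each and is linear in the weights.\<close>
  have "u *\<^sub>R corr_map n \<mu> + v *\<^sub>R corr_map n \<nu> = corr_map n \<kappa>"
    by (simp add: corr_map_eq_sum \<mu> \<nu> \<kappa> pmf scaleR_sum_right scaleR_left_distrib sum.distrib)
  with \<kappa> show "u *\<^sub>R corr_map n \<mu> + v *\<^sub>R corr_map n \<nu> \<in> corr_map n ` sym_bernoulli n"
    by simp
qed

text \<open>For one inclusion the probabilities themselves are the convex coefficients. For the
  other, the image is convex and contains each generator as the correlation vector of a diagonal
  distribution.\<close>

lemma corr_map_image_eq_convex_hull:
  assumes "n \<ge> 1"
  shows "corr_map n ` sym_bernoulli n = convex hull (sign_vector n ` cube n)"
proof (intro equalityI hull_minimal convex_corr_map_image)
  show "corr_map n ` sym_bernoulli n \<subseteq> convex hull (sign_vector n ` cube n)"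
    using corr_map_in_convex_hull by blast
  show "sign_vector n ` cube n \<subseteq> corr_map n ` sym_bernoulli n"
    using corr_map_diag_pmf[OF assms] diag_pmf_in_sym_bernoulli[OF assms]
    by (metis image_eqI image_subsetI)
qed

section \<open>Extremality of sign vectors in the box\<close>

lemma convex_edge_box: "convex (edge_box n)"
proof (rule convexI)
  fix x y and u v :: real
  assume "x \<in> edge_box n" "y \<in> edge_box n" and uv: "0 \<le> u" "0 \<le> v" "u + v = 1"
  then have "u * x e + v * y e \<in> {-1..1}" if "e \<in> edges n" for e
    using that convexD[OF convex_real_interval(5)[of "-1" 1], of "x e" "y e" u v]
    by (simp add: edge_box_def)
  then show "u *\<^sub>R x + v *\<^sub>R y \<in> edge_box n"
    using \<open>x \<in> edge_box n\<close> \<open>y \<in> edge_box n\<close> by (simp add: edge_box_def)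
qed

text \<open>On each edge the coordinate is an endpoint of [-1, 1], so it is a proper convex
  combination of two numbers in [-1, 1] only if both equal it. Off the edges all box vectors
  agree.\<close>

lemma sign_vector_extreme_point_of_edge_box:
  assumes "x \<in> cube n"
  shows "sign_vector n x extreme_point_of edge_box n"
  unfolding extreme_point_of_def
proof (intro conjI ballI notI sign_vector_in_edge_box assms)
  fix a b assume a: "a \<in> edge_box n" and b: "b \<in> edge_box n"
    and "sign_vector n x \<in> open_segment a b"
  then obtain u where "a \<noteq> b" and u: "0 < u" "u < 1"
    and eq: "sign_vector n x = (1 - u) *\<^sub>R a + u *\<^sub>R b"
    by (auto simp: in_segment)
  have "a e = b e" for e
  proof (cases "e \<in> edges n")
    case True
    with a b have ab: "-1 \<le> a e" "a e \<le> 1" "-1 \<le> b e" "b e \<le> 1"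
      by (auto simp: edge_box_def)
    \<comment> \<open>The bounds on the two weighted terms add up to 1 above and -1 below. A sum
      equal to 1 or -1 therefore forces each term to attain its own bound.\<close>
    have bounds: "(1 - u) * a e \<le> 1 - u" "- (1 - u) \<le> (1 - u) * a e" "u * b e \<le> u" "- u \<le> u * b e"
      using ab u mult_left_mono[of "a e" 1 "1 - u"] mult_left_mono[of "-1" "a e" "1 - u"]
        mult_left_mono[of "b e" 1 u] mult_left_mono[of "-1" "b e" u] by simp_all
    have "sign_vector n x e = (1 - u) * a e + u * b e" by (simp add: eq)
    with sign_vector_edge[OF assms True] consider
      "(1 - u) * a e + u * b e = -1" | "(1 - u) * a e + u * b e = 1" by auto
    then show ?thesis
    proof cases
      case 1
      have "(1 - u) * a e = - (1 - u)" using 1 bounds by linarith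
      then have "(1 - u) * a e = (1 - u) * (-1)" by simp
      moreover have "u * b e = u * (-1)" using 1 bounds by linarith
      ultimately have "a e = -1" "b e = -1" using u unfolding mult_cancel_left by auto
      then show ?thesis by simp
    next
      case 2
      have "(1 - u) * a e = 1 - u" using 2 bounds by linarith
      then have "(1 - u) * a e = (1 - u) * 1" by simp
      moreover have "u * b e = u * 1" using 2 bounds by linarith
      ultimately have "a e = 1" "b e = 1" using u unfolding mult_cancel_left by auto
      then show ?thesis by simp
    qed
  next
    case False
    with a b show ?thesis by (cases e) (simp add: edge_box_def)
  qed
  with \<open>a \<noteq> b\<close> show False by blast
qed

section \<open>Numbering of the diagonals\<close>

lemma numbered_diag_pmf_eq:
  assumes "n \<ge> 1" "y \<in> cube n" "y 1 = 0"
  shows "numbered_diag_pmf n (diag_number n y) = diag_pmf n y"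
proof -
  have "diag_number n y \<in> {1..2 ^ (n - 1)}"
    using bij_betwE[OF diag_number_bij_betw[OF assms(1)]] assms by blast
  then show ?thesis
    unfolding numbered_diag_pmf_def
    using the1_equality[OF diag_number_ex1[OF assms(1)], of "diag_number n y" y] assms by simp
qed

text \<open>The numbers run over the half of the cube with first coordinate 0. This half meets every
  diagonal, and the sign vector depends only on the diagonal.\<close>

lemma corr_map_numbered_image:
  assumes "n \<ge> 1"
  shows "(\<lambda>k. corr_map n (numbered_diag_pmf n k)) ` {1..2 ^ (n - 1)} = sign_vector n ` cube n"
proof -
  have "(\<lambda>k. corr_map n (numbered_diag_pmf n k)) ` {1..2 ^ (n - 1)} =
      (\<lambda>y. corr_map n (numbered_diag_pmf n (diag_number n y))) ` {y \<in> cube n. y 1 = 0}"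
    by (simp only: image_image flip: bij_betw_imp_surj_on[OF diag_number_bij_betw[OF assms]])
  also have "\<dots> = sign_vector n ` {y \<in> cube n. y 1 = 0}"
    by (rule image_cong)
      (simp_all add: numbered_diag_pmf_eq corr_map_diag_pmf assms del: One_nat_def)
  also have "\<dots> = sign_vector n ` cube n"
  proof (rule equalityI, blast, rule image_subsetI)
    fix x assume x: "x \<in> cube n"
    show "sign_vector n x \<in> sign_vector n ` {y \<in> cube n. y 1 = 0}"
    proof (cases "x 1 = 0")
      case True
      with x show ?thesis by blast
    next
      case False
      then have "flip n x 1 = 0" using cube_values[OF x, of 1] assms by (simp add: flip_def)
      then show ?thesis
        using flip_in_cube[OF x] sign_vector_flip[OF x, symmetric] by blast
    qed
  qed
  finally show ?thesis .
qed

section \<open>Vertices and convex combinations of the correlation polytope\<close>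

theorem theorem1:
  fixes n :: nat
  assumes "n \<ge> 1"
  shows "corr_map n ` sym_bernoulli n \<subseteq> edge_box n \<and>
    polytope (corr_map n ` sym_bernoulli n) \<and>
    {v. v extreme_point_of (corr_map n ` sym_bernoulli n)} =
      {corr_map n (numbered_diag_pmf n k) | k. k \<in> {1..2 ^ (n - 1)}} \<and>
    (\<forall>\<rho>\<in>edge_box n. (\<exists>\<mu>\<in>sym_bernoulli n. \<rho> = corr_map n \<mu>) \<longleftrightarrow>
      (\<exists>c :: nat \<Rightarrow> real. (\<forall>k\<in>{1..2 ^ (n - 1)}. c k \<ge> 0) \<and> (\<Sum>k=1..2 ^ (n - 1). c k) = 1 \<and>
        \<rho> = (\<Sum>k=1..2 ^ (n - 1). c k *\<^sub>R corr_map n (numbered_diag_pmf n k))))"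
proof -
  let ?R = "corr_map n ` sym_bernoulli n"
  let ?V = "sign_vector n ` cube n"
  let ?w = "\<lambda>k. corr_map n (numbered_diag_pmf n k)"
  note hull = corr_map_image_eq_convex_hull[OF assms]
  note numbered = corr_map_numbered_image[OF assms]
  have box: "?R \<subseteq> edge_box n"
    unfolding hull by (intro hull_minimal convex_edge_box) (auto intro: sign_vector_in_edge_box)
  have polytope: "polytope ?R"
    unfolding polytope_def hull using finite_cube by blast
  have "v extreme_point_of ?R \<longleftrightarrow> v \<in> ?V" for v
  proof
    assume "v extreme_point_of ?R"
    then show "v \<in> ?V" unfolding hull by (rule extreme_point_of_convex_hull)
  next
    assume v: "v \<in> ?V"
    \<comment> \<open>Extremality passes from the box to any subset that contains the point, since
      there are fewer segments to test.\<close>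
    then have "v extreme_point_of edge_box n"
      using sign_vector_extreme_point_of_edge_box by blast
    moreover have "v \<in> ?R" unfolding hull using v by (rule hull_inc)
    ultimately show "v extreme_point_of ?R"
      using box unfolding extreme_point_of_def by blast
  qed
  then have extreme: "{v. v extreme_point_of ?R} = {?w k | k. k \<in> {1..2 ^ (n - 1)}}"
    by (simp only: Setcompr_eq_image numbered Collect_mem_eq)
  have "(\<exists>\<mu>\<in>sym_bernoulli n. \<rho> = corr_map n \<mu>) \<longleftrightarrow>
      (\<exists>c :: nat \<Rightarrow> real. (\<forall>k\<in>{1..2 ^ (n - 1)}. c k \<ge> 0) \<and> (\<Sum>k=1..2 ^ (n - 1). c k) = 1 \<and>
        \<rho> = (\<Sum>k=1..2 ^ (n - 1). c k *\<^sub>R ?w k))" for \<rho>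
  proof -
    have "(\<exists>\<mu>\<in>sym_bernoulli n. \<rho> = corr_map n \<mu>) \<longleftrightarrow> \<rho> \<in> ?R" by blast
    \<comment> \<open>Generating the hull by the family indexed by \<open>k\<close> attaches the
      coefficients to the numbers \<open>k\<close>, as the sums in the claim require.\<close>
    also have "?R = convex hull (?w ` {1..2 ^ (n - 1)})" unfolding hull numbered ..
    finally show ?thesis by (simp only: convex_hull_image_finite[OF finite_atLeastAtMost] mem_Collect_eq)
  qed
  with box polytope extreme show ?thesis by blast
qed

end
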